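(* Under Martin's Axiom, $\mathfrak q_i=\mathfrak c$ for every $i\in\{0,1,2,2\frac12,3\}$.
   Context: $\mathfrak c$ denotes the cardinality of the continuum. A subset of a topological space is of type $F_\sigma$ if it can be written as the union of countably many closed sets. A topological space $X$ is a $Q$-space if every subset of $X$ is of type $F_\sigma$ in $X$. A topological space $X$ is a $T_1$-space if every finite subset of $X$ is closed in $X$; a $T_2$-space if it is Hausdorff, i.e. any distinct points of $X$ have disjoint neighborhoods; a $T_{2\frac12}$-space if it is Urysohn, i.e. any distinct points of $X$ have disjoint closed neighborhoods; a $T_3$-space if $X$ is Hausdorff and every neighborhood of any point $x\in X$ contains a closed neighborhood of $x$. $X$ is second-countable if it has a countable base of the topology. For $i\in\{1,2,2\frac12,3\}$, $\mathfrak q_i$ denotes the smallest cardinality of a second-countable $T_i$-space which is not a $Q$-space. The cardinal $\mathfrak q_0$ is the smallest cardinality of a subset of $\mathbb R$ (with the subspace topology) which is not a $Q$-space. *)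

theory Defs
  imports "HOL-Analysis.Analysis"
begin

unbundle cardinal_syntax

section \<open>Martin's Axiom\<close>

text \<open>A forcing poset is a set \<open>P\<close> with a relation \<open>r\<close>; \<open>(p, q) \<in> r\<close> means that \<open>p\<close> is below
  (stronger than) \<open>q\<close>.\<close>

definition compatible :: "'p set \<Rightarrow> 'p rel \<Rightarrow> 'p \<Rightarrow> 'p \<Rightarrow> bool" where
  "compatible P r p q \<longleftrightarrow> (\<exists>s\<in>P. (s, p) \<in> r \<and> (s, q) \<in> r)"

definition ccc :: "'p set \<Rightarrow> 'p rel \<Rightarrow> bool" where
  "ccc P r \<longleftrightarrow>
     (\<forall>A\<subseteq>P. (\<forall>p\<in>A. \<forall>q\<in>A. p \<noteq> q \<longrightarrow> \<not> compatible P r p q) \<longrightarrow> countable A)"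

definition dense_in_poset :: "'p set \<Rightarrow> 'p rel \<Rightarrow> 'p set \<Rightarrow> bool" where
  "dense_in_poset P r D \<longleftrightarrow> D \<subseteq> P \<and> (\<forall>p\<in>P. \<exists>d\<in>D. (d, p) \<in> r)"

definition filter_in_poset :: "'p set \<Rightarrow> 'p rel \<Rightarrow> 'p set \<Rightarrow> bool" where
  "filter_in_poset P r G \<longleftrightarrow>
     G \<subseteq> P \<and> G \<noteq> {} \<and>
     (\<forall>p\<in>G. \<forall>q\<in>P. (p, q) \<in> r \<longrightarrow> q \<in> G) \<and>
     (\<forall>p\<in>G. \<forall>q\<in>G. \<exists>s\<in>G. (s, p) \<in> r \<and> (s, q) \<in> r)"

text \<open>HOL cannot quantify over all posets at once, so the axiom is relative to a type \<open>'p\<close> that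
  supplies the elements of the posets. It is meant for types of size at least continuum. For
  such a type it is a consequence of the axiom for all posets, so assuming it for just one
  such type is no stronger than assuming Martin's Axiom.\<close>

definition Martins_Axiom :: "'p itself \<Rightarrow> bool" where
  "Martins_Axiom (_ :: 'p itself) \<longleftrightarrow>
     (\<forall>(P :: 'p set) r \<D>.
        P \<noteq> {} \<and> partial_order_on P r \<and> ccc P r \<and>
        |\<D>| <o |UNIV :: real set| \<and> (\<forall>D\<in>\<D>. dense_in_poset P r D) \<longrightarrow>
        (\<exists>G. filter_in_poset P r G \<and> (\<forall>D\<in>\<D>. G \<inter> D \<noteq> {})))"


section \<open>Q-spaces and separation axioms\<close>

definition Q_space :: "'a topology \<Rightarrow> bool" where
  "Q_space X \<longleftrightarrow> (\<forall>S\<subseteq>topspace X. fsigma_in X S)"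

definition Urysohn_space :: "'a topology \<Rightarrow> bool" where
  "Urysohn_space X \<longleftrightarrow>
     (\<forall>x\<in>topspace X. \<forall>y\<in>topspace X. x \<noteq> y \<longrightarrow>
        (\<exists>U V C D. openin X U \<and> openin X V \<and> closedin X C \<and> closedin X D \<and>
           x \<in> U \<and> U \<subseteq> C \<and> y \<in> V \<and> V \<subseteq> D \<and> disjnt C D))"

definition T3_space :: "'a topology \<Rightarrow> bool" where
  "T3_space X \<longleftrightarrow> Hausdorff_space X \<and> neighbourhood_base_of (closedin X) X"


section \<open>The cardinals\<close>

text \<open>A least element of a set of cardinals. It exists whenever the set is nonempty, and is unique
  up to \<open>=o\<close>; for the empty set the value is unspecified.\<close>

definition least_cardinal :: "'a rel set \<Rightarrow> 'a rel" where
  "least_cardinal K = (SOME \<kappa>. \<kappa> \<in> K \<and> (\<forall>\<mu>\<in>K. \<kappa> \<le>o \<mu>))"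

text \<open>Here \<open>'a\<close> supplies the points of the spaces. A second-countable T1 space has at most continuum
  many points, so every type of size at least continuum realises all of these spaces up to
  homeomorphism.\<close>

definition q_cardinal :: "('a topology \<Rightarrow> bool) \<Rightarrow> 'a rel" where
  "q_cardinal T =
     least_cardinal {|topspace X| | X. second_countable X \<and> T X \<and> \<not> Q_space X}"

definition q0 :: "real rel" where
  "q0 = least_cardinal {|A| | A. \<not> Q_space (subtopology euclideanreal A)}"

definition q1 :: "'a rel" where
  "q1 = q_cardinal t1_space"

definition q2 :: "'a rel" where
  "q2 = q_cardinal Hausdorff_space"

definition q2_half :: "'a rel" where
  "q2_half = q_cardinal Urysohn_space"

definition q3 :: "'a rel" where
  "q3 = q_cardinal T3_space"

end

theory Submission
  imports Defs
begin

text \<open>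
  All five cardinals are squeezed between \<open>\<cc>\<close> and \<open>\<cc>\<close>. The upper bound holds in ZFC: the real line is
  second countable, satisfies every separation axiom considered, and is not a \<open>Q\<close>-space, because by
  the Baire category theorem the set of irrational numbers is not of type \<open>F\<^sub>\<sigma>\<close>
  (\<open>not_Q_space_euclideanreal\<close>).

  The lower bound needs only the weakest separation axiom: under Martin's Axiom every second-countable
  \<open>T\<^sub>1\<close>-space \<open>X\<close> with fewer than \<open>\<cc>\<close> points is a \<open>Q\<close>-space (\<open>Martins_Axiom_imp_Q_space\<close>).
  Given \<open>A \<subseteq> X\<close> and a countable base \<open>U\<^sub>0, U\<^sub>1, \<dots>\<close>, one forces open sets \<open>W\<^sub>0, W\<^sub>1, \<dots>\<close> with
  \<open>(\<Inter>n. W\<^sub>n) = X - A\<close>. A condition is a finite amount of information of two kinds: positive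
  decisions ``\<open>U\<^sub>m\<close> is part of \<open>W\<^sub>n\<close>'' and promises ``the point \<open>a \<in> A\<close> stays out of \<open>W\<^sub>n\<close>'',
  subject to no decision breaking a promise. Conditions with the same positive decisions are
  compatible, and there are only countably many finite sets of decisions; this gives the
  countable chain condition. For \<open>b \<notin> A\<close> it is dense that \<open>b\<close> is put into \<open>W\<^sub>n\<close>: some \<open>U\<^sub>m\<close>
  contains \<open>b\<close> and misses the finitely many promised points, as finite sets are closed. For \<open>a \<in> A\<close>
  it is dense that \<open>a\<close> is promised to stay out of some \<open>W\<^sub>n\<close>: take \<open>n\<close> about which nothing has been
  decided. These are \<open>|X| \<cdot> \<aleph>\<^sub>0 < \<cc>\<close> dense sets, and a filter meeting all of them yields the \<open>W\<^sub>n\<close>.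
\<close>

section \<open>Martin's Axiom for posets of bounded size\<close>

text \<open>The axiom speaks about posets inside one fixed type. Its hypotheses and conclusion are invariant
  under isomorphism, so it applies to every poset that injects into that type.\<close>

lemma Martins_Axiom_small_poset:
  fixes P :: "'q set"
  assumes MA: "Martins_Axiom TYPE('p)" and small: "|P| \<le>o |UNIV :: 'p set|"
    and P: "P \<noteq> {}" "partial_order_on P r" "ccc P r"
    and \<D>: "|\<D>| <o |UNIV :: real set|" "\<And>D. D \<in> \<D> \<Longrightarrow> dense_in_poset P r D"
  obtains G where "filter_in_poset P r G" "\<And>D. D \<in> \<D> \<Longrightarrow> G \<inter> D \<noteq> {}"
proof -
  obtain h :: "'q \<Rightarrow> 'p" where h: "inj_on h P"
    using small card_of_ordLeq by metis
  have rP: "r \<subseteq> P \<times> P" and refl: "refl_on P r" and trans: "trans r" and anti: "antisym r"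
    using P(2) by (auto simp: partial_order_on_def preorder_on_def)
  define P' r' where "P' = h ` P" and "r' = {(h p, h q) | p q. (p, q) \<in> r}"
  have h_eq: "h p = h q \<longleftrightarrow> p = q" if "p \<in> P" "q \<in> P" for p q
    using h that by (auto simp: inj_on_def)
  have r'_iff: "(h p, h q) \<in> r' \<longleftrightarrow> (p, q) \<in> r" if "p \<in> P" "q \<in> P" for p q
    using that h_eq rP unfolding r'_def by blast
  have "partial_order_on P' r'"
    unfolding partial_order_on_def preorder_on_def
  proof (intro conjI)
    show "r' \<subseteq> P' \<times> P'"
      using rP by (auto simp: r'_def P'_def)
    show "refl_on P' r'"
      using refl by (auto simp: refl_on_def r'_def P'_def)
    show "trans r'"
    proof (rule transI)
      fix x y z assume "(x, y) \<in> r'" "(y, z) \<in> r'"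
      then obtain p q q' s where pq: "x = h p" "y = h q" "(p, q) \<in> r"
        and qs: "y = h q'" "z = h s" "(q', s) \<in> r"
        unfolding r'_def by blast
      then have "q = q'"
        using h_eq rP by blast
      then show "(x, z) \<in> r'"
        using pq qs trans unfolding r'_def by (blast dest: transD)
    qed
    show "antisym r'"
    proof (rule antisymI)
      fix x y assume xy: "(x, y) \<in> r'" "(y, x) \<in> r'"
      then obtain p q where pq: "x = h p" "y = h q" "(p, q) \<in> r"
        unfolding r'_def by blast
      then have "(q, p) \<in> r"
        using xy r'_iff rP by blast
      then show "x = y"
        using pq anti by (auto dest: antisymD)
    qed
  qed
  moreover have "ccc P' r'"
    unfolding ccc_def
  proof (intro allI impI)
    fix C assume C: "C \<subseteq> P'" and anti': "\<forall>p\<in>C. \<forall>q\<in>C. p \<noteq> q \<longrightarrow> \<not> compatible P' r' p q"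
    have "\<not> compatible P r p q" if pq: "p \<in> P \<inter> h -` C" "q \<in> P \<inter> h -` C" "p \<noteq> q" for p q
    proof
      assume "compatible P r p q"
      then have "compatible P' r' (h p) (h q)"
        using pq r'_iff unfolding compatible_def P'_def by blast
      moreover have "h p \<in> C" "h q \<in> C" "h p \<noteq> h q"
        using pq h_eq by auto
      ultimately show False
        using anti' by blast
    qed
    then have "countable (P \<inter> h -` C)"
      using P(3)[unfolded ccc_def, rule_format, of "P \<inter> h -` C"] by simp
    moreover have "C = h ` (P \<inter> h -` C)"
      using C unfolding P'_def by blast
    ultimately show "countable C"
      by (metis countable_image)
  qed
  moreover have "|(`) h ` \<D>| <o |UNIV :: real set|"
    using card_of_image \<D>(1) ordLeq_ordLess_trans by blast
  moreover have "dense_in_poset P' r' D'" if D': "D' \<in> (`) h ` \<D>" for D'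
  proof -
    obtain D where D: "D \<in> \<D>" "D' = h ` D"
      using D' by blast
    then show ?thesis
      using \<D>(2)[OF D(1)] r'_iff unfolding dense_in_poset_def P'_def by blast
  qed
  moreover have "P' \<noteq> {}"
    using P(1) by (simp add: P'_def)
  ultimately obtain G' where G': "filter_in_poset P' r' G'" "\<forall>D'\<in>(`) h ` \<D>. G' \<inter> D' \<noteq> {}"
    using MA unfolding Martins_Axiom_def by meson
  have G'_P: "G' \<subseteq> P'" and ne: "G' \<noteq> {}"
    and up: "\<And>x y. x \<in> G' \<Longrightarrow> y \<in> P' \<Longrightarrow> (x, y) \<in> r' \<Longrightarrow> y \<in> G'"
    and directed: "\<And>x y. x \<in> G' \<Longrightarrow> y \<in> G' \<Longrightarrow> \<exists>t\<in>G'. (t, x) \<in> r' \<and> (t, y) \<in> r'"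
    using G'(1) by (simp_all add: filter_in_poset_def)
  define G where "G = P \<inter> h -` G'"
  have in_G: "p \<in> G \<longleftrightarrow> p \<in> P \<and> h p \<in> G'" for p
    by (simp add: G_def)
  show thesis
  proof
    show "filter_in_poset P r G"
      unfolding filter_in_poset_def
    proof (intro conjI ballI impI)
      show "G \<subseteq> P"
        by (simp add: G_def)
      show "G \<noteq> {}"
        using ne G'_P in_G unfolding P'_def by blast
      show "q \<in> G" if "p \<in> G" "q \<in> P" "(p, q) \<in> r" for p q
        using that up[of "h p" "h q"] r'_iff by (simp add: in_G P'_def)
      show "\<exists>s\<in>G. (s, p) \<in> r \<and> (s, q) \<in> r" if pq: "p \<in> G" "q \<in> G" for p q
      proof -
        obtain t where t: "t \<in> G'" "(t, h p) \<in> r'" "(t, h q) \<in> r'"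
          using directed pq in_G by blast
        then obtain s where "s \<in> P" "t = h s"
          using G'_P unfolding P'_def by blast
        then have "s \<in> G" "(s, p) \<in> r" "(s, q) \<in> r"
          using t pq r'_iff by (simp_all add: in_G)
        then show ?thesis
          by blast
      qed
    qed
    show "G \<inter> D \<noteq> {}" if D: "D \<in> \<D>" for D
    proof -
      obtain d where d: "d \<in> D" "h d \<in> G'"
        using G'(2) D by blast
      moreover have "d \<in> P"
        using \<D>(2)[OF D] d(1) by (auto simp: dense_in_poset_def)
      ultimately show ?thesis
        by (auto simp: G_def)
    qed
  qed
qed


section \<open>Cardinalities below the continuum\<close>

lemma countable_ordLess_continuum:
  assumes "countable S"
  shows "|S| <o |UNIV :: real set|"
proof -
  have "\<not> |UNIV :: real set| \<le>o |S|"
    using assms uncountable_UNIV_real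
    by (metis card_of_ordLeq countable_image_inj_on countable_subset)
  then show ?thesis
    by (simp add: not_ordLeq_iff_ordLess card_of_Well_order)
qed

lemma Times_nat_ordLess_continuum:
  assumes "|S| <o |UNIV :: real set|"
  shows "|S \<times> (UNIV :: nat set)| <o |UNIV :: real set|"
proof (cases "finite S")
  case True
  then show ?thesis
    by (intro countable_ordLess_continuum) (auto intro: countable_finite)
next
  case False
  then have "|S \<times> (UNIV :: nat set)| =o |S|"
    by (intro card_of_Times_infinite_simps) (simp_all flip: infinite_iff_card_of_nat)
  then show ?thesis
    using assms ordIso_ordLess_trans by blast
qed

lemma continuum_ordIso_nat_sets: "|UNIV :: nat set set| =o |UNIV :: real set|"
  using nat_sets_eqpoll_reals unfolding eqpoll_def card_of_ordIso .


section \<open>The forcing notion\<close>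

text \<open>In a condition \<open>(f, K)\<close>, a pair \<open>(m, n) \<in> f\<close> decides that \<open>U m\<close> becomes part of the \<open>n\<close>-th
  open set, and a pair \<open>(a, n) \<in> K\<close> promises that \<open>a\<close> will not belong to the \<open>n\<close>-th open set.\<close>

definition conditions :: "(nat \<Rightarrow> 'a set) \<Rightarrow> 'a set \<Rightarrow> ((nat \<times> nat) set \<times> ('a \<times> nat) set) set" where
  "conditions U A = {(f, K). finite f \<and> finite K \<and> K \<subseteq> A \<times> UNIV \<and>
     (\<forall>(m, n) \<in> f. \<forall>a. (a, n) \<in> K \<longrightarrow> a \<notin> U m)}"

definition extends :: "(nat \<Rightarrow> 'a set) \<Rightarrow> 'a set \<Rightarrow> ((nat \<times> nat) set \<times> ('a \<times> nat) set) rel" where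
  "extends U A = {(p, q). p \<in> conditions U A \<and> q \<in> conditions U A \<and> fst q \<subseteq> fst p \<and> snd q \<subseteq> snd p}"

lemma partial_order_on_extends: "partial_order_on (conditions U A) (extends U A)"
  unfolding partial_order_on_def preorder_on_def
  by (auto simp: extends_def refl_on_def trans_def antisym_def)

text \<open>The poset is even \<open>\<sigma>\<close>-centred: promises never conflict with each other, so two conditions with
  the same decisions are both extended by the union of their promises.\<close>

lemma ccc_conditions: "ccc (conditions U A) (extends U A)"
  unfolding ccc_def
proof (intro allI impI)
  fix C assume C: "C \<subseteq> conditions U A"
    and anti: "\<forall>p\<in>C. \<forall>q\<in>C. p \<noteq> q \<longrightarrow> \<not> compatible (conditions U A) (extends U A) p q"
  have "inj_on fst C"
  proof (rule inj_onI, rule ccontr)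
    fix p q assume pq: "p \<in> C" "q \<in> C" "fst p = fst q" "p \<noteq> q"
    obtain f K K' where eq: "p = (f, K)" "q = (f, K')"
      using pq(3) by (metis prod.collapse)
    have p: "p \<in> conditions U A" and q: "q \<in> conditions U A"
      using pq C by auto
    then have "(f, K \<union> K') \<in> conditions U A"
      unfolding eq conditions_def by blast
    then have "compatible (conditions U A) (extends U A) p q"
      using p q unfolding compatible_def extends_def eq
      by (intro bexI[of _ "(f, K \<union> K')"]) auto
    with pq anti show False
      by blast
  qed
  moreover have "fst ` C \<subseteq> Collect finite"
    using C by (auto simp: conditions_def)
  then have "countable (fst ` C)"
    by (rule countable_subset[OF _ countable_Collect_finite])
  ultimately show "countable C"
    using countable_image_inj_on by blast
qed

locale countable_base =
  fixes X :: "'a topology" and U :: "nat \<Rightarrow> 'a set"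
  assumes open_base: "openin X (U m)"
    and base: "openin X V \<Longrightarrow> x \<in> V \<Longrightarrow> \<exists>m. x \<in> U m \<and> U m \<subseteq> V"

lemma second_countable_imp_countable_base:
  assumes "second_countable X"
  obtains U where "countable_base X U"
proof -
  obtain \<B> where \<B>: "countable \<B>" "\<And>V. V \<in> \<B> \<Longrightarrow> openin X V"
    "\<And>V x. openin X V \<Longrightarrow> x \<in> V \<Longrightarrow> \<exists>B\<in>\<B>. x \<in> B \<and> B \<subseteq> V"
    using assms unfolding second_countable_def by metis
  \<comment> \<open>The empty set is added because an enumeration has to be of a nonempty set.\<close>
  have range: "range (from_nat_into (insert {} \<B>)) = insert {} \<B>"
    using \<B>(1) by (simp add: range_from_nat_into)
  show thesis
  proof
    show "countable_base X (from_nat_into (insert {} \<B>))"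
    proof
      show "openin X (from_nat_into (insert {} \<B>) m)" for m
        using range \<B>(2) by (metis insert_iff openin_empty rangeI)
      show "\<exists>m. x \<in> from_nat_into (insert {} \<B>) m \<and> from_nat_into (insert {} \<B>) m \<subseteq> V"
        if "openin X V" "x \<in> V" for V x
        using \<B>(3)[OF that] range by (metis insertCI rangeE)
    qed
  qed
qed

locale countable_base_t1 = countable_base +
  assumes t1: "t1_space X"
begin

lemma base_avoids_finite:
  assumes "b \<in> topspace X" "finite S" "b \<notin> S" "S \<subseteq> topspace X"
  obtains m where "b \<in> U m" "U m \<inter> S = {}"
proof -
  have "closedin X S"
    using t1 assms by (simp add: t1_space_closedin_finite)
  then have "openin X (topspace X - S)"
    by blast
  then obtain m where "b \<in> U m" "U m \<subseteq> topspace X - S"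
    using base assms by blast
  then show thesis
    using that by blast
qed

text \<open>A finite set of points is closed, hence determined by the basic open sets that it meets. In this
  way a condition is coded by a set of natural numbers.\<close>

lemma card_conditions:
  assumes A: "A \<subseteq> topspace X"
  shows "|conditions U A| \<le>o |UNIV :: real set|"
proof -
  define trace where "trace K = {(m, n). \<exists>a. a \<in> U m \<and> (a, n) \<in> K}" for K :: "('a \<times> nat) set"
  have promises_subset: "K \<subseteq> K'"
    if K: "K \<subseteq> A \<times> UNIV" and K': "finite K'" "K' \<subseteq> A \<times> UNIV" and "trace K = trace K'" for K K'
  proof (rule subrelI, rule ccontr)
    fix a n assume an: "(a, n) \<in> K" "(a, n) \<notin> K'"
    define S where "S = {a'. (a', n) \<in> K'}"
    have "S \<subseteq> fst ` K'"
      unfolding S_def by force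
    then have "finite S"
      using K'(1) finite_surj by blast
    moreover have "S \<subseteq> topspace X" "a \<in> topspace X" "a \<notin> S"
      using an K K'(2) A by (auto simp: S_def)
    ultimately obtain m where m: "a \<in> U m" "U m \<inter> S = {}"
      using base_avoids_finite by metis
    then have "(m, n) \<in> trace K"
      using an by (auto simp: trace_def)
    moreover have "(m, n) \<notin> trace K'"
      using m by (auto simp: trace_def S_def)
    ultimately show False
      using \<open>trace K = trace K'\<close> by blast
  qed
  define code :: "(nat \<times> nat) set \<times> ('a \<times> nat) set \<Rightarrow> nat set"
    where "code = (\<lambda>(f, K). to_nat ` (Inl ` f \<union> Inr ` trace K))"
  have "inj_on code (conditions U A)"
  proof (rule inj_onI, clarify)
    fix f K f' K'
    assume fK: "(f, K) \<in> conditions U A" "(f', K') \<in> conditions U A" "code (f, K) = code (f', K')"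
    then have "Inl ` f \<union> Inr ` trace K = Inl ` f' \<union> Inr ` trace K'"
      unfolding code_def by (simp add: inj_image_eq_iff)
    then have "f = f'" "trace K = trace K'"
      by blast+
    moreover from this have "K = K'"
      using fK promises_subset[of K K'] promises_subset[of K' K] by (auto simp: conditions_def)
    ultimately show "f = f' \<and> K = K'"
      by blast
  qed
  then have "|conditions U A| \<le>o |UNIV :: nat set set|"
    using card_of_ordLeq by blast
  then show ?thesis
    using continuum_ordIso_nat_sets ordLeq_ordIso_trans by blast
qed

lemma dense_decide_point:
  assumes A: "A \<subseteq> topspace X" and b: "b \<in> topspace X - A"
  shows "dense_in_poset (conditions U A) (extends U A)
    {p \<in> conditions U A. \<exists>m. (m, n) \<in> fst p \<and> b \<in> U m}"
  unfolding dense_in_poset_def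
proof (intro conjI ballI)
  fix p assume p: "p \<in> conditions U A"
  obtain f K where eq: "p = (f, K)"
    by (cases p)
  have K: "finite K" "K \<subseteq> A \<times> UNIV"
    using p by (auto simp: eq conditions_def)
  have "finite (fst ` K)" "fst ` K \<subseteq> A"
    using K by auto
  then obtain m where m: "b \<in> U m" "U m \<inter> fst ` K = {}"
    using base_avoids_finite[of b "fst ` K"] A b by blast
  have "a \<notin> U m" if "(a, n) \<in> K" for a
    using that m(2) by force
  then have "(insert (m, n) f, K) \<in> conditions U A"
    using p by (auto simp: eq conditions_def)
  then show "\<exists>d\<in>{p \<in> conditions U A. \<exists>m. (m, n) \<in> fst p \<and> b \<in> U m}. (d, p) \<in> extends U A"
    using p m(1) by (intro bexI[of _ "(insert (m, n) f, K)"]) (auto simp: eq extends_def)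
qed auto

lemma dense_promise_point:
  assumes a: "a \<in> A"
  shows "dense_in_poset (conditions U A) (extends U A) {p \<in> conditions U A. \<exists>n. (a, n) \<in> snd p}"
  unfolding dense_in_poset_def
proof (intro conjI ballI)
  fix p assume p: "p \<in> conditions U A"
  obtain f K where eq: "p = (f, K)"
    by (cases p)
  have "finite (snd ` f)"
    using p by (simp add: eq conditions_def)
  then obtain n where n: "n \<notin> snd ` f"
    using ex_new_if_finite infinite_UNIV_nat by blast
  have "(m, n) \<notin> f" for m
    using n by force
  then have "(f, insert (a, n) K) \<in> conditions U A"
    using p a by (auto simp: eq conditions_def)
  then show "\<exists>d\<in>{p \<in> conditions U A. \<exists>n. (a, n) \<in> snd p}. (d, p) \<in> extends U A"
    using p by (intro bexI[of _ "(f, insert (a, n) K)"]) (auto simp: eq extends_def)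
qed auto

lemma fsigma_in_Martins_Axiom:
  assumes MA: "Martins_Axiom TYPE('p)" and c: "|UNIV :: real set| \<le>o |UNIV :: 'p set|"
    and small: "|topspace X| <o |UNIV :: real set|" and A: "A \<subseteq> topspace X"
  shows "fsigma_in X A"
proof -
  let ?P = "conditions U A"
  define decide where "decide = (\<lambda>(b, n). {p \<in> ?P. \<exists>m. (m, n) \<in> fst p \<and> b \<in> U m})"
  define promise where "promise = (\<lambda>a. {p \<in> ?P. \<exists>n. (a, n) \<in> snd p})"
  define \<D> where "\<D> = decide ` ((topspace X - A) \<times> UNIV) \<union> promise ` A"
  have "|topspace X - A| <o |UNIV :: real set|"
    using small card_of_mono1[OF Diff_subset] ordLeq_ordLess_trans by blast
  then have "|decide ` ((topspace X - A) \<times> UNIV)| <o |UNIV :: real set|"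
    using Times_nat_ordLess_continuum card_of_image ordLeq_ordLess_trans by blast
  moreover have "|A| <o |UNIV :: real set|"
    using small card_of_mono1[OF A] ordLeq_ordLess_trans by blast
  then have "|promise ` A| <o |UNIV :: real set|"
    using card_of_image ordLeq_ordLess_trans by blast
  ultimately have card_\<D>: "|\<D>| <o |UNIV :: real set|"
    unfolding \<D>_def by (intro card_of_Un_ordLess_infinite) (simp_all add: infinite_UNIV_char_0)
  have dense_\<D>: "dense_in_poset ?P (extends U A) D" if "D \<in> \<D>" for D
    using that dense_decide_point[OF A] dense_promise_point
    unfolding \<D>_def decide_def promise_def by auto
  have "({}, {}) \<in> ?P"
    by (simp add: conditions_def)
  then have "?P \<noteq> {}"
    by blast
  moreover have "|?P| \<le>o |UNIV :: 'p set|"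
    using card_conditions[OF A] c ordLeq_transitive by blast
  ultimately obtain G where G: "filter_in_poset ?P (extends U A) G"
    and generic: "\<And>D. D \<in> \<D> \<Longrightarrow> G \<inter> D \<noteq> {}"
    using Martins_Axiom_small_poset[OF MA _ _ partial_order_on_extends ccc_conditions card_\<D>] dense_\<D>
    by metis
  define W where "W n = \<Union>{U m | m. \<exists>p\<in>G. (m, n) \<in> fst p}" for n
  have W_open: "openin X (W n)" for n
    unfolding W_def using open_base by (intro openin_Union) blast
  have "(\<Inter>n. W n) = topspace X - A"
  proof (intro equalityI subsetI)
    fix b assume b: "b \<in> topspace X - A"
    have "b \<in> W n" for n
    proof -
      have "decide (b, n) \<in> \<D>"
        using b by (auto simp: \<D>_def)
      then show ?thesis
        using generic[of "decide (b, n)"] unfolding W_def decide_def by blast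
    qed
    then show "b \<in> (\<Inter>n. W n)"
      by blast
  next
    fix x assume x: "x \<in> (\<Inter>n. W n)"
    have "x \<notin> A"
    proof
      assume "x \<in> A"
      then obtain q n where q: "q \<in> G" "(x, n) \<in> snd q"
        using generic[of "promise x"] by (auto simp: \<D>_def promise_def)
      have "x \<in> W n"
        using x by blast
      then obtain m p where p: "p \<in> G" "(m, n) \<in> fst p" "x \<in> U m"
        by (auto simp: W_def)
      \<comment> \<open>A common extension would contain a decision together with a promise that it breaks.\<close>
      obtain s where "(s, p) \<in> extends U A" "(s, q) \<in> extends U A"
        using G p q unfolding filter_in_poset_def by blast
      then have "s \<in> ?P" "(m, n) \<in> fst s" "(x, n) \<in> snd s"
        using p q by (auto simp: extends_def)
      then show False
        using p(3) unfolding conditions_def by fastforce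
    qed
    moreover have "x \<in> topspace X"
      using x W_open openin_subset by blast
    ultimately show "x \<in> topspace X - A"
      by blast
  qed
  moreover have "gdelta_in X (\<Inter>n. W n)"
    by (intro gdelta_in_Inter) (auto intro: open_imp_gdelta_in W_open)
  ultimately show ?thesis
    using A by (simp add: fsigma_in_gdelta_in)
qed

end

theorem Martins_Axiom_imp_Q_space:
  assumes "Martins_Axiom TYPE('p)" "|UNIV :: real set| \<le>o |UNIV :: 'p set|"
    and "second_countable X" "t1_space X" "|topspace X| <o |UNIV :: real set|"
  shows "Q_space X"
proof -
  obtain U where "countable_base X U"
    using second_countable_imp_countable_base assms(3) .
  then interpret countable_base_t1 X U
    using assms(4) by (simp add: countable_base_t1_def countable_base_t1_axioms_def)
  show ?thesis
    unfolding Q_space_def using fsigma_in_Martins_Axiom assms by blast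
qed


section \<open>The real line and its copies\<close>

text \<open>If the irrationals were a countable union of closed sets, these sets together with the rational
  singletons would be countably many closed sets with empty interior that cover the line.\<close>

lemma not_Q_space_euclideanreal: "\<not> Q_space euclideanreal"
proof
  assume "Q_space euclideanreal"
  then have "fsigma_in euclideanreal (- \<rat>)"
    by (auto simp: Q_space_def)
  then obtain \<C> :: "real set set" where \<C>: "countable \<C>" "\<C> \<subseteq> Collect closed" "\<Union>\<C> = - \<rat>"
    unfolding fsigma_in_def union_of_def closed_closedin[symmetric] by blast
  have "euclideanreal interior_of \<Union>(\<C> \<union> (\<lambda>q. {q}) ` \<rat>) = {}"
  proof (rule Baire_category_alt)
    show "completely_metrizable_space euclideanreal \<or>
        locally_compact_space euclideanreal \<and> regular_space euclideanreal"
      by (simp add: completely_metrizable_space_euclidean)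
    show "countable (\<C> \<union> (\<lambda>q. {q}) ` \<rat>)"
      using \<C>(1) countable_rat by blast
    fix T :: "real set" assume T: "T \<in> \<C> \<union> (\<lambda>q. {q}) ` \<rat>"
    then have "closed T"
      using \<C>(2) by auto
    moreover have "interior T = {}"
    proof (cases "T \<in> \<C>")
      case True
      then have "interior T \<inter> \<rat> = {}"
        using \<C>(3) interior_subset by blast
      then show ?thesis
        using open_Int_closure_eq_empty[OF open_interior, of T \<rat>] by (simp add: Rats_closure_real)
    next
      case False
      then show ?thesis
        using T by auto
    qed
    ultimately show "closedin euclideanreal T \<and> euclideanreal interior_of T = {}"
      by simp
  qed
  moreover have "\<Union>(\<C> \<union> (\<lambda>q. {q}) ` \<rat>) = UNIV"
    using \<C>(3) by auto
  ultimately show False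
    by simp
qed

lemma second_countable_euclidean:
  "second_countable (euclidean :: 'a :: second_countable_topology topology)"
proof -
  obtain B :: "'a set set" where B: "countable B" "topological_basis B"
    using ex_countable_basis by blast
  show ?thesis
    unfolding second_countable_def
  proof (intro exI[of _ B] conjI ballI allI impI)
    show "openin euclidean V" if "V \<in> B" for V
      using that B(2) by (simp add: topological_basis_open)
    show "\<exists>V\<in>B. x \<in> V \<and> V \<subseteq> U" if "openin euclidean U \<and> x \<in> U" for U x
    proof -
      have "open U" "x \<in> U"
        using that by simp_all
      then show ?thesis
        using topological_basisE[OF B(2) \<open>open U\<close> \<open>x \<in> U\<close>] by metis
    qed
  qed (fact B(1))
qed

lemma homeomorphic_Q_space:
  assumes "X homeomorphic_space Y" "Q_space X"
  shows "Q_space Y"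
proof -
  obtain f where f: "homeomorphic_map X Y f"
    using assms(1) by (auto simp: homeomorphic_space)
  show ?thesis
    unfolding Q_space_def
  proof (intro allI impI)
    fix S assume S: "S \<subseteq> topspace Y"
    have img: "f ` topspace X = topspace Y"
      using f homeomorphic_imp_surjective_map by blast
    define R where "R = topspace X \<inter> f -` S"
    have "S = f ` R"
      using S unfolding R_def img[symmetric] by auto
    moreover have "R \<subseteq> topspace X"
      unfolding R_def by blast
    moreover from this have "fsigma_in X R"
      using assms(2) by (simp add: Q_space_def)
    ultimately show "fsigma_in Y S"
      using homeomorphic_map_fsigmaness[OF f] by simp
  qed
qed

lemma T3_space_imp_Urysohn_space:
  assumes "T3_space X"
  shows "Urysohn_space X"
  unfolding Urysohn_space_def
proof (intro ballI impI)
  fix x y assume "x \<in> topspace X" "y \<in> topspace X" "x \<noteq> y"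
  then obtain V W where VW: "openin X V" "openin X W" "x \<in> V" "y \<in> W" "disjnt V W"
    using assms unfolding T3_space_def Hausdorff_space_def by metis
  have nb: "\<And>W z. openin X W \<Longrightarrow> z \<in> W \<Longrightarrow>
      \<exists>U C. openin X U \<and> closedin X C \<and> z \<in> U \<and> U \<subseteq> C \<and> C \<subseteq> W"
    using assms unfolding T3_space_def neighbourhood_base_of by meson
  obtain U C where UC: "openin X U" "closedin X C" "x \<in> U" "U \<subseteq> C" "C \<subseteq> V"
    using nb VW by metis
  obtain U' D where UD: "openin X U'" "closedin X D" "y \<in> U'" "U' \<subseteq> D" "D \<subseteq> W"
    using nb VW by metis
  have "disjnt C D"
    using UC UD VW by (meson disjnt_subset1 disjnt_subset2)
  then show "\<exists>U V C D. openin X U \<and> openin X V \<and> closedin X C \<and> closedin X D \<and>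
      x \<in> U \<and> U \<subseteq> C \<and> y \<in> V \<and> V \<subseteq> D \<and> disjnt C D"
    using UC UD by blast
qed

lemma Urysohn_space_imp_Hausdorff_space:
  assumes "Urysohn_space X"
  shows "Hausdorff_space X"
  unfolding Hausdorff_space_def
proof (intro allI impI)
  fix x y assume "x \<in> topspace X \<and> y \<in> topspace X \<and> x \<noteq> y"
  then obtain U V C D where "openin X U" "openin X V" "x \<in> U" "U \<subseteq> C" "y \<in> V" "V \<subseteq> D" "disjnt C D"
    using assms unfolding Urysohn_space_def by metis
  then show "\<exists>U V. openin X U \<and> openin X V \<and> x \<in> U \<and> y \<in> V \<and> disjnt U V"
    by (meson disjnt_subset1 disjnt_subset2)
qed

lemma T3_copy_of_real_line:
  assumes "|UNIV :: real set| \<le>o |UNIV :: 'a set|"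
  obtains X :: "'a topology" where "second_countable X" "T3_space X" "\<not> Q_space X"
    "|topspace X| =o |UNIV :: real set|"
proof -
  obtain e :: "real \<Rightarrow> 'a" where e: "inj e"
    using assms card_of_ordLeq by metis
  define X where "X = pullback_topology (range e) (inv e) euclideanreal"
  have top: "topspace X = range e"
    by (simp add: X_def topspace_pullback_topology)
  have "homeomorphic_maps euclideanreal X e (inv e)"
    unfolding homeomorphic_maps_def
  proof (intro conjI ballI)
    show "continuous_map euclideanreal X e"
      unfolding X_def by (rule continuous_map_pullback') (auto simp: e o_def)
    show "continuous_map X euclideanreal (inv e)"
      using continuous_map_pullback[OF continuous_map_id, of "range e" "inv e" euclideanreal]
      by (simp add: X_def)
  qed (use e top in auto)
  then have hom: "euclideanreal homeomorphic_space X"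
    by (auto simp: homeomorphic_space_def)
  show thesis
  proof
    show "second_countable X"
      using hom homeomorphic_space_second_countability second_countable_euclidean by blast
    have "Hausdorff_space X" "regular_space X"
      using homeomorphic_Hausdorff_space[OF hom] homeomorphic_regular_space[OF hom]
      by (auto simp: regular_space_euclidean)
    then show "T3_space X"
      by (simp add: T3_space_def neighbourhood_base_of_closedin)
    show "\<not> Q_space X"
      using hom homeomorphic_Q_space homeomorphic_space_sym not_Q_space_euclideanreal by blast
    have "bij_betw e UNIV (topspace X)"
      using e top by (simp add: bij_betw_def)
    then show "|topspace X| =o |UNIV :: real set|"
      using card_of_ordIso ordIso_symmetric by blast
  qed
qed


section \<open>The cardinals under Martin's Axiom\<close>

lemma least_cardinal_ordIso:
  fixes \<kappa> :: "'a rel" and \<nu> :: "'b rel"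
  assumes "\<kappa> \<in> K" "\<kappa> =o \<nu>" "\<And>\<mu>. \<mu> \<in> K \<Longrightarrow> \<nu> \<le>o \<mu>"
  shows "least_cardinal K =o \<nu>"
proof -
  have "\<kappa> \<in> K \<and> (\<forall>\<mu>\<in>K. \<kappa> \<le>o \<mu>)"
    using assms ordIso_ordLeq_trans by blast
  then have least: "least_cardinal K \<in> K \<and> (\<forall>\<mu>\<in>K. least_cardinal K \<le>o \<mu>)"
    unfolding least_cardinal_def by (rule someI)
  then have "least_cardinal K \<le>o \<nu>"
    using assms(1,2) ordLeq_ordIso_trans by blast
  then show ?thesis
    using least assms(3) ordIso_iff_ordLeq by blast
qed

text \<open>The value does not depend on the separation axiom, as long as it lies between \<open>T\<^sub>1\<close> and \<open>T\<^sub>3\<close>: the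
  lower bound comes from all \<open>T\<^sub>1\<close>-spaces, and the space witnessing the upper bound is \<open>T\<^sub>3\<close>.\<close>

lemma q_cardinal_Martins_Axiom:
  assumes c: "|UNIV :: real set| \<le>o |UNIV :: 'p set|" and MA: "Martins_Axiom TYPE('p)"
    and a: "|UNIV :: real set| \<le>o |UNIV :: 'a set|"
    and t1: "\<And>X :: 'a topology. T X \<Longrightarrow> t1_space X"
    and T3: "\<And>X :: 'a topology. T3_space X \<Longrightarrow> T X"
  shows "q_cardinal T =o |UNIV :: real set|"
proof -
  obtain X :: "'a topology" where X: "second_countable X" "T3_space X" "\<not> Q_space X"
    "|topspace X| =o |UNIV :: real set|"
    using T3_copy_of_real_line[OF a] .
  have "|UNIV :: real set| \<le>o |topspace Y|"
    if "second_countable Y" "T Y" "\<not> Q_space Y" for Y :: "'a topology"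
    using Martins_Axiom_imp_Q_space[OF MA c that(1) t1] that
    by (meson card_of_Well_order not_ordLeq_iff_ordLess)
  then show ?thesis
    unfolding q_cardinal_def using X T3 by (intro least_cardinal_ordIso[of "|topspace X|"]) auto
qed

lemma q0_Martins_Axiom:
  assumes c: "|UNIV :: real set| \<le>o |UNIV :: 'p set|" and MA: "Martins_Axiom TYPE('p)"
  shows "q0 =o |UNIV :: real set|"
proof -
  have "|UNIV :: real set| \<le>o |A|" if "\<not> Q_space (subtopology euclideanreal A)" for A
  proof -
    have "second_countable (subtopology euclideanreal A)"
      by (intro second_countable_subtopology second_countable_euclidean)
    moreover have "t1_space (subtopology euclideanreal A)"
      by (intro Hausdorff_imp_t1_space Hausdorff_space_subtopology) simp
    ultimately show ?thesis
      using Martins_Axiom_imp_Q_space[OF MA c, of "subtopology euclideanreal A"] that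
      by (auto simp: card_of_Well_order simp flip: not_ordLeq_iff_ordLess)
  qed
  moreover have "\<not> Q_space (subtopology euclideanreal UNIV)"
    using not_Q_space_euclideanreal by simp
  ultimately show ?thesis
    unfolding q0_def by (intro least_cardinal_ordIso[of "|UNIV :: real set|"]) (auto simp: card_of_refl)
qed

theorem corollary10:
  assumes "|UNIV :: real set| \<le>o |UNIV :: 'p set|"
    and "Martins_Axiom TYPE('p)"
    and "|UNIV :: real set| \<le>o |UNIV :: 'a set|"
  shows "q0 =o |UNIV :: real set| \<and>
    (q1 :: 'a rel) =o |UNIV :: real set| \<and>
    (q2 :: 'a rel) =o |UNIV :: real set| \<and>
    (q2_half :: 'a rel) =o |UNIV :: real set| \<and>
    (q3 :: 'a rel) =o |UNIV :: real set|"
  unfolding q1_def q2_def q2_half_def q3_def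
  using T3_space_imp_Urysohn_space Urysohn_space_imp_Hausdorff_space Hausdorff_imp_t1_space
  by (intro conjI q0_Martins_Axiom[OF assms(1,2)] q_cardinal_Martins_Axiom[OF assms]; blast)

end
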